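(* Let $d$ be a compatible left-invariant metric on a topological group $G$. Then the following conditions are equivalent. (1) $d$ is minimal. (2) There is an open set $U\ni 1$ in $G$ so that, for all $g\in G$ and all integers $n\geqslant 1$, $$g, g^2, g^3,\ldots, g^n\in U \;\Rightarrow\; d(g,1)\leqslant \frac 1n.$$ (3) There are constants $\epsilon>0$ and $K\geqslant 1$ so that, for all $g\in G$ and all integers $n\geqslant 1$, $$d(g,1)\leqslant \frac{\epsilon}{n}\;\Rightarrow\; n\cdot d(g,1)\leqslant K\cdot d(g^n,1).$$ (4) There are an open set $U\ni 1$ in $G$ and a constant $K\geqslant 1$ so that, for all $g\in G$ and all integers $n\geqslant 1$, $$g, g^2, g^4, g^8,\ldots, g^{2^n}\in U\;\Rightarrow\; 2^n\cdot d(g,1)\leqslant K\cdot d(g^{2^n},1).$$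
   Context: $1$ denotes the identity element of $G$. A metric $d$ on a topological group $G$ is compatible if it induces the topology of $G$, and left-invariant if $d(hg,hf)=d(g,f)$ for all $g,f,h\in G$. A metric $d$ on $G$ is minimal if it is compatible, left-invariant and, for every other compatible left-invariant metric $\partial$ on $G$, there are an identity neighbourhood $U$ and a constant $K$ (both possibly depending on $\partial$) so that $d(g,f)\leqslant K\cdot\partial(g,f)$ for all $g,f\in U$. *)

theory Defs
  imports "HOL-Algebra.Group" "HOL-Analysis.Abstract_Metric_Spaces"
begin

definition topological_group :: "('a, 'b) monoid_scheme \<Rightarrow> 'a topology \<Rightarrow> bool" where
  "topological_group G T \<longleftrightarrow>
     group G \<and> topspace T = carrier G \<and>
     continuous_map (prod_topology T T) T (\<lambda>(x, y). x \<otimes>\<^bsub>G\<^esub> y) \<and>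
     continuous_map T T (\<lambda>x. inv\<^bsub>G\<^esub> x)"

text \<open>
  A metric on the group is a metric on its carrier in the sense of \<^locale>\<open>Metric_space\<close>.
  That locale also asks for symmetry and nonnegativity off the carrier, which is no
  restriction: every metric on the carrier extends by zero, and none of the notions below
  depends on the values off the carrier.
\<close>

definition compatible_metric ::
    "('a, 'b) monoid_scheme \<Rightarrow> 'a topology \<Rightarrow> ('a \<Rightarrow> 'a \<Rightarrow> real) \<Rightarrow> bool" where
  "compatible_metric G T d \<longleftrightarrow>
     Metric_space (carrier G) d \<and> Metric_space.mtopology (carrier G) d = T"

definition left_invariant_metric ::
    "('a, 'b) monoid_scheme \<Rightarrow> ('a \<Rightarrow> 'a \<Rightarrow> real) \<Rightarrow> bool" where
  "left_invariant_metric G d \<longleftrightarrow>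
     (\<forall>g\<in>carrier G. \<forall>f\<in>carrier G. \<forall>h\<in>carrier G.
        d (h \<otimes>\<^bsub>G\<^esub> g) (h \<otimes>\<^bsub>G\<^esub> f) = d g f)"

text \<open>
  Neighbourhoods need not be open: \<open>U\<close> is an identity neighbourhood if the identity lies in
  its interior.
\<close>

definition minimal_metric ::
    "('a, 'b) monoid_scheme \<Rightarrow> 'a topology \<Rightarrow> ('a \<Rightarrow> 'a \<Rightarrow> real) \<Rightarrow> bool" where
  "minimal_metric G T d \<longleftrightarrow>
     compatible_metric G T d \<and> left_invariant_metric G d \<and>
     (\<forall>d'. compatible_metric G T d' \<and> left_invariant_metric G d' \<longrightarrow>
        (\<exists>U K. U \<subseteq> carrier G \<and> \<one>\<^bsub>G\<^esub> \<in> T interior_of U \<and>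
           (\<forall>g\<in>U. \<forall>f\<in>U. d g f \<le> K * d' g f)))"

end

theory Submission
  imports Defs "HOL-Algebra.Coset"
begin

text \<open>
  The bound \<open>d g \<one> \<le> 1 / n\<close> for all \<open>g\<close> whose first \<open>n\<close> powers lie in a fixed neighbourhood of the
  identity is called the escape property here. Its equivalence with the two growth conditions is
  elementary (\<open>escape_imp_linear_growth\<close>, \<open>linear_growth_imp_dyadic_growth\<close>,
  \<open>dyadic_growth_imp_escape\<close>). Given the growth bound for exponents \<open>n\<close> with \<open>n * d g \<one> \<le> \<epsilon>\<close>, an
  element whose powers \<open>g [^] 2 ^ k\<close>, \<open>k \<le> N\<close>, stay very close to the identity satisfies
  \<open>2 ^ k * d g \<one> \<le> \<epsilon>\<close> for all these \<open>k\<close>, by induction on \<open>k\<close>, and so the growth bound applies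
  to it. The dyadic bound gives the escape property because each \<open>n \<ge> 1\<close> lies between consecutive
  powers of \<open>2\<close>. To get the growth bound from the escape property, one writes an exponent as
  \<open>n * a + b\<close> with \<open>b < n\<close> to see that, if \<open>n * d g \<one>\<close> and \<open>d (g [^] n) \<one>\<close> are small, then the powers
  of \<open>g\<close> stay near the identity up to an exponent of order \<open>n / d (g [^] n) \<one>\<close>.

  The escape property implies minimality (\<open>escape_imp_minimal\<close>): if \<open>d'\<close> is another compatible
  left-invariant metric and \<open>d' g \<one>\<close> is small, then the powers of \<open>g\<close> stay in a given
  neighbourhood up to an exponent of order \<open>1 / d' g \<one>\<close>, since \<open>d' (g [^] n) \<one> \<le> n * d' g \<one>\<close>.

  The main point is that minimality implies the escape property (\<open>minimal_imp_escape\<close>). If the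
  escape property fails, there are, arbitrarily close to the identity, elements \<open>g\<close> and exponents
  \<open>m\<close> such that \<open>g, \<dots>, g [^] m\<close> are all small although \<open>1 < m * d g \<one>\<close>. One chooses a base of
  neighbourhoods \<open>A 0, A 1, \<dots>\<close> with the square of \<open>A (n + 1)\<close> inside \<open>A n\<close>, each of which, after \<open>A 0\<close>, is a
  small tube around the powers of exponent at most \<open>k\<close> in absolute value of one such element. From
  one step to the next, \<open>k\<close> is halved; a tube of the right radius exists because only finitely many
  conjugations are involved and each is continuous (\<open>ex_power_tube_square\<close>). When \<open>k\<close> has come
  down from \<open>m\<close> to \<open>1\<close>, at step \<open>n\<close> say, a new and much smaller violation of the escape property
  takes over. The Birkhoff--Kakutani construction gives a compatible left-invariant metric for
  which elements of \<open>A n\<close> are at distance of order at most \<open>1 / 2 ^ n\<close> from the identity. If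
  the tubes of \<open>g\<close> started at step \<open>b\<close>, then \<open>2 ^ (n - b)\<close> is comparable with \<open>m\<close>, hence
  \<open>d g \<one>\<close> is at least of order \<open>2 ^ b / 2 ^ n\<close>. As \<open>b\<close> is arbitrarily large, no bound of \<open>d\<close> by a
  multiple of the new metric holds near the identity.
\<close>

section \<open>Groups with a left-invariant metric\<close>

locale inv_metric_group = group G + Metric_space "carrier G" d
  for G :: "('a, 'b) monoid_scheme" (structure) and d :: "'a \<Rightarrow> 'a \<Rightarrow> real" +
  assumes left_inv: "\<lbrakk>x \<in> carrier G; y \<in> carrier G; z \<in> carrier G\<rbrakk> \<Longrightarrow> d (z \<otimes> x) (z \<otimes> y) = d x y"
begin

lemma dist_one_mult_le:
  assumes "x \<in> carrier G" "y \<in> carrier G"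
  shows "d (x \<otimes> y) \<one> \<le> d x \<one> + d y \<one>"
proof -
  have "d (x \<otimes> y) \<one> \<le> d (x \<otimes> y) x + d x \<one>"
    using assms by (intro triangle) auto
  moreover have "d (x \<otimes> y) x = d y \<one>"
    using left_inv[of y \<one> x] assms by simp
  ultimately show ?thesis by simp
qed

lemma dist_eq_dist_one:
  assumes "x \<in> carrier G" "y \<in> carrier G"
  shows "d x y = d (inv x \<otimes> y) \<one>"
  using left_inv[of x y "inv x"] assms commute[of \<one>] by simp

lemma dist_inv_one: "x \<in> carrier G \<Longrightarrow> d (inv x) \<one> = d x \<one>"
  using dist_eq_dist_one[of x \<one>] by simp

lemma dist_pow_one_le: "x \<in> carrier G \<Longrightarrow> d (x [^] (n::nat)) \<one> \<le> real n * d x \<one>"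
proof (induction n)
  case 0
  then show ?case by (simp add: mdist_zero)
next
  case (Suc n)
  have "d (x [^] n \<otimes> x) \<one> \<le> d (x [^] n) \<one> + d x \<one>"
    using Suc.prems by (intro dist_one_mult_le) auto
  with Suc show ?case by (simp add: algebra_simps)
qed

lemma mem_mball_one: "x \<in> mball \<one> r \<longleftrightarrow> x \<in> carrier G \<and> d x \<one> < r"
  by (auto simp: commute)

lemma ex_mball_one_subset:
  assumes "openin mtopology U" "\<one> \<in> U"
  obtains r where "r > 0" "mball \<one> r \<subseteq> U"
  using assms unfolding openin_mtopology by blast

text \<open>
  By left-invariance, two metrics can be compared at the identity alone.
\<close>

lemma openin_mtopology_if_finer:
  assumes d': "inv_metric_group G d'"
    and fine: "\<And>e. e > 0 \<Longrightarrow> \<exists>r>0. \<forall>x\<in>carrier G. d x \<one> < r \<longrightarrow> d' x \<one> < e"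
    and U: "openin (Metric_space.mtopology (carrier G) d') U"
  shows "openin mtopology U"
proof -
  interpret D: inv_metric_group G d' by (rule d')
  have "\<exists>r>0. mball x r \<subseteq> U" if "x \<in> U" for x
  proof -
    from U that obtain e where e: "e > 0" "D.mball x e \<subseteq> U"
      unfolding D.openin_mtopology by blast
    from fine[OF e(1)] obtain r where
      r: "r > 0" "\<forall>x\<in>carrier G. d x \<one> < r \<longrightarrow> d' x \<one> < e" by blast
    have "mball x r \<subseteq> D.mball x e"
    proof
      fix y assume "y \<in> mball x r"
      then have y: "x \<in> carrier G" "y \<in> carrier G" "d x y < r" by auto
      then have "d' (inv x \<otimes> y) \<one> < e"
        using r dist_eq_dist_one[of x y] by auto
      then show "y \<in> D.mball x e" using y D.dist_eq_dist_one[of x y] by auto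
    qed
    with e r show ?thesis by blast
  qed
  moreover have "U \<subseteq> carrier G" using U D.openin_mtopology by blast
  ultimately show ?thesis unfolding openin_mtopology by blast
qed

lemma ex_ball_conj:
  assumes "topological_group G mtopology" "p \<in> carrier G" "e > 0"
  shows "\<exists>r>0. \<forall>w\<in>carrier G. d w \<one> < r \<longrightarrow> d (inv p \<otimes> w \<otimes> p) \<one> < e"
proof -
  have mult: "continuous_map (prod_topology mtopology mtopology) mtopology (\<lambda>(x, y). x \<otimes> y)"
    using assms(1) by (simp add: topological_group_def)
  have const: "continuous_map mtopology mtopology (\<lambda>w. q)" if "q \<in> carrier G" for q
    using that by simp
  have c1: "continuous_map mtopology mtopology (\<lambda>w. inv p \<otimes> w)"
    using continuous_map_compose[OF continuous_map_pairedI[OF const[of "inv p"] continuous_map_id[unfolded id_def]] mult]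
      assms(2) by (simp add: o_def)
  have c2: "continuous_map mtopology mtopology (\<lambda>w. inv p \<otimes> w \<otimes> p)"
    using continuous_map_compose[OF continuous_map_pairedI[OF c1 const[of p]] mult]
      assms(2) by (simp add: o_def)
  have "openin mtopology {w \<in> topspace mtopology. inv p \<otimes> w \<otimes> p \<in> mball \<one> e}"
    using c2 openin_mball by (rule openin_continuous_map_preimage)
  moreover have "\<one> \<in> {w \<in> topspace mtopology. inv p \<otimes> w \<otimes> p \<in> mball \<one> e}"
    using assms by (simp add: mdist_zero)
  ultimately obtain r where "r > 0" "mball \<one> r \<subseteq> {w \<in> topspace mtopology. inv p \<otimes> w \<otimes> p \<in> mball \<one> e}"
    by (rule ex_mball_one_subset)
  then show ?thesis by (intro exI[of _ r]) (auto simp: commute subset_iff)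
qed

lemma ex_ball_conj_finite:
  assumes "topological_group G mtopology" "finite F" "F \<subseteq> carrier G" "e > 0"
  shows "\<exists>r>0. \<forall>p\<in>F. \<forall>w\<in>carrier G. d w \<one> < r \<longrightarrow> d (inv p \<otimes> w \<otimes> p) \<one> < e"
  using assms(2,3)
proof (induction F rule: finite_induct)
  case empty
  then show ?case by (auto intro: exI[of _ 1])
next
  case (insert p F)
  then obtain r where r: "r > 0"
    "\<forall>p\<in>F. \<forall>w\<in>carrier G. d w \<one> < r \<longrightarrow> d (inv p \<otimes> w \<otimes> p) \<one> < e" by blast
  obtain s where s: "s > 0" "\<forall>w\<in>carrier G. d w \<one> < s \<longrightarrow> d (inv p \<otimes> w \<otimes> p) \<one> < e"
    using ex_ball_conj[OF assms(1) _ assms(4)] insert.prems by blast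
  from r s show ?case by (intro exI[of _ "min r s"]) auto
qed

section \<open>Three forms of the escape property\<close>

text \<open>If \<open>1 < n * d g \<one>\<close>, then one of the first \<open>n\<close> powers of \<open>g\<close> lies outside \<open>U\<close>.\<close>

definition escape :: "'a set \<Rightarrow> bool" where
  "escape U \<longleftrightarrow> (\<forall>g\<in>carrier G. \<forall>n::nat. n \<ge> 1 \<longrightarrow>
     (\<forall>k\<in>{1..n}. g [^] k \<in> U) \<longrightarrow> d g \<one> \<le> 1 / real n)"

text \<open>
  The distance of \<open>g [^] n\<close> from the identity grows linearly in \<open>n\<close>, up to the factor \<open>K\<close>, as long
  as \<open>n * d g \<one>\<close> is at most \<open>\<epsilon>\<close>.
\<close>

definition linear_growth :: "real \<Rightarrow> real \<Rightarrow> bool" where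
  "linear_growth \<epsilon> K \<longleftrightarrow> (\<forall>g\<in>carrier G. \<forall>n::nat. n \<ge> 1 \<longrightarrow>
     d g \<one> \<le> \<epsilon> / real n \<longrightarrow> real n * d g \<one> \<le> K * d (g [^] n) \<one>)"

text \<open>
  The same growth along the exponents \<open>2 ^ n\<close>, as long as the iterated squares of \<open>g\<close> stay in \<open>U\<close>.
\<close>

definition dyadic_growth :: "'a set \<Rightarrow> real \<Rightarrow> bool" where
  "dyadic_growth U K \<longleftrightarrow> (\<forall>g\<in>carrier G. \<forall>n::nat. n \<ge> 1 \<longrightarrow>
     (\<forall>k\<in>{0..n}. g [^] ((2::nat) ^ k) \<in> U) \<longrightarrow>
     2 ^ n * d g \<one> \<le> K * d (g [^] ((2::nat) ^ n)) \<one>)"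

end

text \<open>
  This converts a bound on \<open>c\<close> in terms of the number of steps of length \<open>r\<close> that fit into \<open>\<eta>\<close> into
  a linear bound of \<open>c\<close> by \<open>r\<close>. The case \<open>r = 0\<close> is allowed and forces \<open>c = 0\<close>.
\<close>

lemma le_if_multiples_le:
  fixes c r \<eta> :: real
  assumes "c \<ge> 0" "r \<ge> 0" "r \<le> \<eta>" "\<eta> > 0"
    and mult: "\<And>q::nat. q \<ge> 1 \<Longrightarrow> real q * r \<le> \<eta> \<Longrightarrow> real q * c \<le> 1"
  shows "c \<le> 2 / \<eta> * r"
proof (cases "r = 0")
  case True
  have "c = 0"
  proof (rule ccontr)
    assume "c \<noteq> 0"
    with assms(1) obtain q :: nat where q: "1 < real q * c"
      using reals_Archimedean3[of c] by auto
    then have "q \<ge> 1" by (cases q) auto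
    with mult[of q] q True assms(4) show False by simp
  qed
  with True show ?thesis by simp
next
  case False
  with assms have r: "r > 0" by simp
  define q where "q = nat \<lfloor>\<eta> / r\<rfloor>"
  have "\<eta> / r \<ge> 1" using r assms by simp
  then have q1: "q \<ge> 1" and q2: "real q \<le> \<eta> / r" and q3: "\<eta> / r < real q + 1"
    unfolding q_def by linarith+
  have "real q * c \<le> 1" using q1 q2 r by (intro mult) (auto simp: field_simps)
  moreover have "\<eta> / r \<le> 2 * real q" using q1 q3 by linarith
  ultimately have "\<eta> / r * c \<le> 2"
    using mult_right_mono[of "\<eta> / r" "2 * real q" c] assms(1) by linarith
  then show ?thesis using r assms(4) by (simp add: field_simps)
qed

context inv_metric_group
begin

lemma escape_imp_linear_growth:
  assumes "openin mtopology U" "\<one> \<in> U" "escape U"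
  shows "\<exists>\<epsilon> K. \<epsilon> > 0 \<and> K \<ge> 1 \<and> linear_growth \<epsilon> K"
proof -
  obtain r where r: "r > 0" "mball \<one> r \<subseteq> U"
    using assms(1,2) by (rule ex_mball_one_subset)
  \<comment> \<open>A power of \<open>g [^] n\<close> and a remaining power of \<open>g\<close> contribute at most \<open>\<eta>\<close> each, and \<open>2 * \<eta> < r\<close>.\<close>
  define \<eta> where "\<eta> = r / 3"
  have \<eta>: "\<eta> > 0" using r by (simp add: \<eta>_def)
  have "real n * d g \<one> \<le> max 1 (2 / \<eta>) * d (g [^] n) \<one>"
    if g: "g \<in> carrier G" and n: "n \<ge> 1" and le: "d g \<one> \<le> \<eta> / real n" for g and n :: nat
  proof -
    have le': "real n * d g \<one> \<le> \<eta>" using le n by (simp add: field_simps)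
    have "real n * d g \<one> \<le> 2 / \<eta> * d (g [^] n) \<one>"
    proof (rule le_if_multiples_le)
      show "d (g [^] n) \<one> \<le> \<eta>" using dist_pow_one_le[OF g, of n] le' by simp
      show "real q * (real n * d g \<one>) \<le> 1"
        if q: "q \<ge> 1" and qr: "real q * d (g [^] n) \<one> \<le> \<eta>" for q :: nat
      proof -
        have "g [^] k \<in> U" if k: "k \<in> {1..q * n}" for k
        proof -
          define a b where "a = k div n" and "b = k mod n"
          have k_eq: "k = n * a + b" by (simp add: a_def b_def)
          have a: "a \<le> q" using k n div_le_mono[of k "q * n" n] by (simp add: a_def)
          have b: "b \<le> n" using n by (simp add: b_def)
          have "g [^] k = (g [^] n) [^] a \<otimes> g [^] b"
            using g by (simp add: k_eq nat_pow_mult nat_pow_pow)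
          then have "d (g [^] k) \<one> \<le> d ((g [^] n) [^] a) \<one> + d (g [^] b) \<one>"
            using g dist_one_mult_le by simp
          also have "\<dots> \<le> real a * d (g [^] n) \<one> + real b * d g \<one>"
            using g by (intro add_mono dist_pow_one_le) auto
          also have "\<dots> \<le> real q * d (g [^] n) \<one> + real n * d g \<one>"
            using a b by (intro add_mono mult_right_mono) auto
          also have "\<dots> \<le> \<eta> + \<eta>" using qr le' by (rule add_mono)
          also have "\<dots> < r" using r by (simp add: \<eta>_def)
          finally show ?thesis using g r(2) by (auto simp: mem_mball_one subset_iff simp del: in_mball)
        qed
        moreover have "q * n \<ge> 1" using q n by simp
        ultimately have "d g \<one> \<le> 1 / real (q * n)"
          using assms(3) g unfolding escape_def by blast
        then show "real q * (real n * d g \<one>) \<le> 1" using q n by (simp add: field_simps)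
      qed
    qed (use \<eta> in auto)
    also have "\<dots> \<le> max 1 (2 / \<eta>) * d (g [^] n) \<one>" by (intro mult_right_mono) auto
    finally show ?thesis .
  qed
  then show ?thesis unfolding linear_growth_def using \<eta>
    by (intro exI[of _ \<eta>] exI[of _ "max 1 (2 / \<eta>)"]) auto
qed

lemma linear_growth_imp_dyadic_growth:
  assumes "\<epsilon> > 0" "K \<ge> 1" "linear_growth \<epsilon> K"
  shows "dyadic_growth (mball \<one> (\<epsilon> / (2 * K))) K"
  unfolding dyadic_growth_def
proof (intro ballI allI impI)
  fix g and n :: nat
  assume g: "g \<in> carrier G"
    and pow: "\<forall>k\<in>{0..n}. g [^] ((2::nat) ^ k) \<in> mball \<one> (\<epsilon> / (2 * K))"
  have small: "K * d (g [^] ((2::nat) ^ k)) \<one> \<le> \<epsilon> / 2" if "k \<le> n" for k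
  proof -
    have "d (g [^] ((2::nat) ^ k)) \<one> < \<epsilon> / (2 * K)"
      using pow that mem_mball_one atLeastAtMost_iff by blast
    then show ?thesis using assms(2) by (simp add: field_simps)
  qed
  have grow: "2 ^ k * d g \<one> \<le> K * d (g [^] ((2::nat) ^ k)) \<one>" if "2 ^ k * d g \<one> \<le> \<epsilon>" for k
    using assms(3)[unfolded linear_growth_def, rule_format, of g "2 ^ k"] that g
    by (simp add: field_simps)
  have "2 ^ k * d g \<one> \<le> \<epsilon>" if "k \<le> n" for k
    using that
  proof (induction k)
    case 0
    have "d g \<one> \<le> K * d g \<one>" using assms(2) mult_right_mono[of 1 K "d g \<one>"] by simp
    then show ?case using small[of 0] g assms(1) by simp
  next
    case (Suc k)
    then have "2 ^ k * d g \<one> \<le> \<epsilon> / 2" using grow[of k] small[of k] by simp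
    then show ?case by simp
  qed
  then show "2 ^ n * d g \<one> \<le> K * d (g [^] ((2::nat) ^ n)) \<one>" by (intro grow) simp
qed

lemma dyadic_growth_imp_escape:
  assumes "K \<ge> 1" "dyadic_growth U K"
  shows "escape (U \<inter> mball \<one> (1 / (2 * K)))"
  unfolding escape_def
proof (intro ballI allI impI)
  fix g and n :: nat
  assume g: "g \<in> carrier G" and n: "n \<ge> 1"
    and pow: "\<forall>k\<in>{1..n}. g [^] k \<in> U \<inter> mball \<one> (1 / (2 * K))"
  obtain k :: nat where k: "2 ^ k \<le> n" "n < 2 ^ (k + 1)"
    using ex_power_ivl1[of 2 n] n by auto
  have pow2: "g [^] ((2::nat) ^ i) \<in> U \<inter> mball \<one> (1 / (2 * K))" if "i \<le> k" for i
  proof -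
    have "(2::nat) ^ i \<le> 2 ^ k" using that by (intro power_increasing) auto
    then have "(2::nat) ^ i \<le> n" using k(1) by (rule le_trans)
    then have "(2::nat) ^ i \<in> {1..n}" by simp
    then show ?thesis using pow by blast
  qed
  have "2 ^ k * d g \<one> \<le> K * d (g [^] ((2::nat) ^ k)) \<one>"
  proof (cases "k = 0")
    case True
    then show ?thesis using assms(1) g mult_right_mono[of 1 K "d g \<one>"] by simp
  next
    case False
    then show ?thesis using assms(2)[unfolded dyadic_growth_def] g pow2 by auto
  qed
  also have "\<dots> \<le> 1 / 2"
  proof -
    have "d (g [^] ((2::nat) ^ k)) \<one> < 1 / (2 * K)" using pow2[of k] mem_mball_one by blast
    then show ?thesis using assms(1) by (simp add: field_simps)
  qed
  finally have "2 ^ (k + 1) * d g \<one> \<le> 1" by simp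
  moreover have "real n \<le> 2 ^ (k + 1)"
    using k(2) by (metis less_imp_le of_nat_le_iff of_nat_numeral of_nat_power)
  ultimately have "real n * d g \<one> \<le> 1"
    using mult_right_mono[of "real n" "2 ^ (k + 1)" "d g \<one>"] by simp
  then show "d g \<one> \<le> 1 / real n" using n by (simp add: field_simps)
qed

section \<open>The escape property implies minimality\<close>

lemma escape_imp_le:
  assumes "openin mtopology U" "\<one> \<in> U" "escape U"
    and d': "inv_metric_group G d'" "Metric_space.mtopology (carrier G) d' = mtopology"
  shows "\<exists>r>0. \<exists>K. \<forall>g\<in>carrier G. d' g \<one> < r \<longrightarrow> d g \<one> \<le> K * d' g \<one>"
proof -
  interpret D: inv_metric_group G d' by (rule d')
  obtain r where r: "r > 0" "D.mball \<one> r \<subseteq> U"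
    using assms(1,2) unfolding d'(2)[symmetric] by (rule D.ex_mball_one_subset)
  have "d g \<one> \<le> 2 / (r / 2) * d' g \<one>" if g: "g \<in> carrier G" "d' g \<one> < r / 2" for g
  proof (rule le_if_multiples_le)
    fix q :: nat assume q: "q \<ge> 1" "real q * d' g \<one> \<le> r / 2"
    have "g [^] k \<in> U" if "k \<in> {1..q}" for k
    proof -
      have "d' (g [^] k) \<one> \<le> real k * d' g \<one>" using g by (intro D.dist_pow_one_le)
      also have "\<dots> \<le> real q * d' g \<one>" using that by (intro mult_right_mono) auto
      also have "\<dots> < r" using q r by simp
      finally show ?thesis using g r(2) D.mem_mball_one by blast
    qed
    then have "d g \<one> \<le> 1 / real q" using assms(3) g q unfolding escape_def by blast
    then show "real q * d g \<one> \<le> 1" using q by (simp add: field_simps)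
  qed (use g r in auto)
  then show ?thesis using r by (intro exI[of _ "r / 2"] conjI exI[of _ "2 / (r / 2)"]) simp_all
qed

lemma escape_imp_minimal:
  assumes "openin mtopology U" "\<one> \<in> U" "escape U"
  shows "minimal_metric G mtopology d"
  unfolding minimal_metric_def
proof (intro conjI allI impI)
  show "compatible_metric G mtopology d"
    by (simp add: compatible_metric_def Metric_space_axioms)
  show "left_invariant_metric G d"
    by (simp add: left_invariant_metric_def left_inv)
  fix d' assume d': "compatible_metric G mtopology d' \<and> left_invariant_metric G d'"
  then interpret D: inv_metric_group G d'
    unfolding compatible_metric_def left_invariant_metric_def
    by (intro inv_metric_group.intro inv_metric_group_axioms.intro) (auto intro: is_group)
  have top: "D.mtopology = mtopology" using d' by (simp add: compatible_metric_def)
  obtain r K where r: "r > 0" and le: "\<forall>g\<in>carrier G. d' g \<one> < r \<longrightarrow> d g \<one> \<le> K * d' g \<one>"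
    using escape_imp_le[OF assms D.inv_metric_group_axioms top] by blast
  show "\<exists>U K. U \<subseteq> carrier G \<and> \<one> \<in> mtopology interior_of U \<and>
           (\<forall>g\<in>U. \<forall>f\<in>U. d g f \<le> K * d' g f)"
  proof (intro exI conjI ballI)
    let ?U = "D.mball \<one> (r / 2)"
    show "?U \<subseteq> carrier G" by auto
    have "openin mtopology ?U" unfolding top[symmetric] by (rule D.openin_mball)
    then show "\<one> \<in> mtopology interior_of ?U" using r by (simp add: interior_of_openin)
    fix g f assume gf: "g \<in> ?U" "f \<in> ?U"
    then have c: "g \<in> carrier G" "f \<in> carrier G" by auto
    have "d' g f \<le> d' g \<one> + d' \<one> f" using c by (intro D.triangle) auto
    also have "\<dots> < r" using gf by (simp add: D.commute)
    finally have "d' (inv g \<otimes> f) \<one> < r" using D.dist_eq_dist_one[OF c] by simp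
    then show "d g f \<le> K * d' g f"
      using le c dist_eq_dist_one[of g f] D.dist_eq_dist_one[of g f] by simp
  qed
qed

end

section \<open>The Birkhoff--Kakutani construction\<close>

text \<open>
  A neighbourhood base at the identity in which the square of each member lies in the preceding
  one. The members need be neither open nor symmetric.
\<close>

locale square_chain = inv_metric_group +
  fixes V :: "nat \<Rightarrow> 'a set"
  assumes V_carrier: "V n \<subseteq> carrier G"
    and V_ball: "\<exists>r>0. mball \<one> r \<subseteq> V n"
    and V_small: "e > 0 \<Longrightarrow> \<exists>n. V n \<subseteq> mball \<one> e"
    and V_square: "\<lbrakk>x \<in> V (Suc n); y \<in> V (Suc n)\<rbrakk> \<Longrightarrow> x \<otimes> y \<in> V n"
begin

lemma one_in_V: "\<one> \<in> V n"
proof -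
  obtain r where "r > 0" "mball \<one> r \<subseteq> V n" using V_ball by blast
  then show ?thesis by (auto simp: subset_iff)
qed

text \<open>
  \<open>dyadic_set n j\<close> is the set attached to the dyadic rational \<open>j / 2 ^ n\<close>. If
  \<open>j / 2 ^ n < 1\<close> has binary digits \<open>1\<close> at the positions \<open>i\<^sub>1 < \<dots> < i\<^sub>l\<close>, then it is the product
  of \<open>V i\<^sub>1, \<dots>, V i\<^sub>l\<close> in this order; from \<open>1\<close> on it is the whole group.
\<close>

primrec dyadic_set :: "nat \<Rightarrow> nat \<Rightarrow> 'a set" where
  "dyadic_set 0 j = (if j = 0 then {\<one>} else carrier G)"
| "dyadic_set (Suc n) j =
     (if even j then dyadic_set n (j div 2) else dyadic_set n (j div 2) <#> V (Suc n))"

lemma dyadic_set_carrier: "dyadic_set n j \<subseteq> carrier G"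
proof (induction n arbitrary: j)
  case (Suc n)
  then show ?case using set_mult_closed[OF Suc V_carrier] by simp
qed simp

lemma dyadic_set_zero: "dyadic_set n 0 = {\<one>}"
  by (induction n) auto

lemma dyadic_set_one: "dyadic_set (Suc n) 1 = V (Suc n)"
  using V_carrier by (auto simp: dyadic_set_zero set_mult_def subset_iff)

text \<open>
  Appending a factor from \<open>V n\<close> amounts to adding \<open>1 / 2 ^ n\<close>. The square condition is what
  makes the carry work.
\<close>

lemma dyadic_set_mult:
  assumes "x \<in> dyadic_set n j" "v \<in> V n"
  shows "x \<otimes> v \<in> dyadic_set n (Suc j)"
  using assms
proof (induction n arbitrary: j x v)
  case 0
  then show ?case using V_carrier by (auto split: if_splits)
next
  case (Suc n)
  show ?case
  proof (cases "even j")
    case True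
    then show ?thesis using Suc.prems by (auto simp: set_mult_def)
  next
    case False
    then obtain a b where ab: "a \<in> dyadic_set n (j div 2)" "b \<in> V (Suc n)" "x = a \<otimes> b"
      using Suc.prems by (auto simp: set_mult_def)
    then have "x \<otimes> v = a \<otimes> (b \<otimes> v)"
      using V_carrier dyadic_set_carrier Suc.prems by (auto simp: m_assoc subset_iff)
    moreover have "a \<otimes> (b \<otimes> v) \<in> dyadic_set n (Suc (j div 2))"
      using Suc.IH ab V_square Suc.prems by blast
    ultimately show ?thesis using False by simp
  qed
qed

lemma dyadic_set_mono: "i \<le> j \<Longrightarrow> dyadic_set n i \<subseteq> dyadic_set n j"
proof (induction j rule: dec_induct)
  case (step j)
  have "x \<in> dyadic_set n (Suc j)" if "x \<in> dyadic_set n j" for x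
    using dyadic_set_mult[OF that one_in_V] that dyadic_set_carrier by (auto simp: subset_iff)
  with step show ?case by blast
qed simp

lemma dyadic_set_refine: "dyadic_set (n + k) (2 ^ k * j) = dyadic_set n j"
  by (induction k) (simp_all add: mult.assoc)

text \<open>Passage to denominator \<open>2 ^ N\<close>, at the cost of rounding up strictly.\<close>

lemma dyadic_set_coarsen:
  assumes "x \<in> dyadic_set n j"
  shows "x \<in> dyadic_set N (j * 2 ^ N div 2 ^ n + 1)"
proof (cases "n \<le> N")
  case True
  then obtain k where k: "N = n + k" using le_Suc_ex by blast
  have "x \<in> dyadic_set N (2 ^ k * j)" using assms by (simp add: k dyadic_set_refine)
  moreover have "2 ^ k * j \<le> j * 2 ^ N div 2 ^ n + 1"
    by (simp add: k power_add mult.commute mult.left_commute)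
  ultimately show ?thesis using dyadic_set_mono by blast
next
  case False
  then obtain k where k: "n = N + k" using le_Suc_ex[of N n] by auto
  have "j * 2 ^ N div 2 ^ n = j div 2 ^ k"
    by (simp add: k power_add mult.commute)
  moreover have "j \<le> 2 ^ k * (j div 2 ^ k + 1)"
    by (metis Suc_eq_plus1 dividend_less_times_div less_imp_le mult_Suc_right add.commute
        zero_less_numeral zero_less_power)
  then have "x \<in> dyadic_set n (2 ^ k * (j div 2 ^ k + 1))"
    using assms dyadic_set_mono by blast
  ultimately show ?thesis unfolding k dyadic_set_refine by simp
qed

text \<open>
  The infimum of the dyadic rationals whose set contains \<open>x\<close>. The number \<open>1\<close> is inserted so that
  off the carrier, where no such rational exists, the infimum is not taken over the empty set;
  hence \<open>level\<close> has values in \<open>[0, 1]\<close> everywhere.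
\<close>

definition level :: "'a \<Rightarrow> real" where
  "level x = Inf (insert 1 {real j / 2 ^ n | n j. x \<in> dyadic_set n j})"

lemma bdd_below_levels: "bdd_below (insert 1 {real j / 2 ^ n | n j. x \<in> dyadic_set n j})"
  by (rule bdd_belowI[of _ 0]) auto

lemma level_nonneg: "level x \<ge> 0"
  unfolding level_def by (rule cInf_greatest) auto

lemma level_le_one: "level x \<le> 1"
  unfolding level_def by (rule cInf_lower[OF _ bdd_below_levels]) simp

lemma level_le: "x \<in> dyadic_set n j \<Longrightarrow> level x \<le> real j / 2 ^ n"
  unfolding level_def by (rule cInf_lower[OF _ bdd_below_levels]) auto

lemma level_one: "level \<one> = 0"
  using level_le[of \<one> 0 0] level_nonneg[of \<one>] by simp

lemma level_mult_le:
  assumes "v \<in> V N"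
  shows "level (x \<otimes> v) \<le> level x + 2 / 2 ^ N"
proof -
  have "level (x \<otimes> v) - 2 / 2 ^ N \<le> t"
    if "t \<in> insert 1 {real j / 2 ^ n | n j. x \<in> dyadic_set n j}" for t
    using that
  proof (elim insertE CollectE exE conjE)
    assume "t = 1"
    then show ?thesis using level_le_one[of "x \<otimes> v"]
      by (smt (verit) divide_nonneg_nonneg zero_le_power)
  next
    fix n j assume t: "t = real j / 2 ^ n" and x: "x \<in> dyadic_set n j"
    define i where "i = j * 2 ^ N div 2 ^ n"
    have "x \<otimes> v \<in> dyadic_set N (i + 2)"
      using dyadic_set_mult[OF dyadic_set_coarsen[OF x] assms] by (simp add: i_def)
    then have "level (x \<otimes> v) \<le> real (i + 2) / 2 ^ N" by (rule level_le)
    moreover have "real i \<le> real (j * 2 ^ N) / real (2 ^ n)"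
      unfolding i_def by (rule of_nat_div_le_of_nat)
    then have "real i / 2 ^ N \<le> t" by (simp add: t field_simps)
    ultimately show ?thesis by (simp add: add_divide_distrib)
  qed
  then have "level (x \<otimes> v) - 2 / 2 ^ N \<le> level x"
    unfolding level_def[of x] by (intro cInf_greatest) auto
  then show ?thesis by simp
qed

lemma in_V_if_level_less:
  assumes "level x < 1 / 2 ^ Suc N"
  shows "x \<in> V (Suc N)"
proof -
  obtain t where "t \<in> insert 1 {real j / 2 ^ n | n j. x \<in> dyadic_set n j}" "t < 1 / 2 ^ Suc N"
    using cInf_lessD[OF insert_not_empty assms[unfolded level_def]] by blast
  moreover have "(1::real) / 2 ^ Suc N \<le> 1"
    using one_le_power[of "2::real" "Suc N"] by (simp add: field_simps)
  ultimately obtain n j where x: "x \<in> dyadic_set n j" and less: "real j / 2 ^ n < 1 / 2 ^ Suc N"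
    by force
  have "real (j * 2 ^ Suc N) < real (2 ^ n)" using less by (simp add: field_simps)
  then have "j * 2 ^ Suc N div 2 ^ n = 0" by (simp only: of_nat_less_iff div_less)
  then show ?thesis using dyadic_set_coarsen[OF x, of "Suc N"] dyadic_set_one by simp
qed

text \<open>
  The supremum over all left translates turns the variation of \<open>level\<close> into a left-invariant
  metric.
\<close>

definition chain_dist :: "'a \<Rightarrow> 'a \<Rightarrow> real" where
  "chain_dist x y = (SUP z\<in>carrier G. \<bar>level (z \<otimes> x) - level (z \<otimes> y)\<bar>)"

lemma level_diff_le_one: "\<bar>level x - level y\<bar> \<le> 1"
  using level_nonneg[of x] level_nonneg[of y] level_le_one[of x] level_le_one[of y] by linarith

lemma level_diff_le_chain_dist:
  "z \<in> carrier G \<Longrightarrow> \<bar>level (z \<otimes> x) - level (z \<otimes> y)\<bar> \<le> chain_dist x y"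
  unfolding chain_dist_def
  by (rule cSUP_upper) (auto intro!: bdd_aboveI[of _ 1] level_diff_le_one)

lemma chain_dist_le:
  assumes "\<And>z. z \<in> carrier G \<Longrightarrow> \<bar>level (z \<otimes> x) - level (z \<otimes> y)\<bar> \<le> c"
  shows "chain_dist x y \<le> c"
  unfolding chain_dist_def using assms by (intro cSUP_least) auto

lemma level_le_chain_dist: "x \<in> carrier G \<Longrightarrow> level x \<le> chain_dist x \<one>"
  using level_diff_le_chain_dist[of \<one> x \<one>] level_nonneg[of x] by (simp add: level_one)

text \<open>
  This estimate is the purpose of the construction: membership of \<open>v\<close> and its inverse in \<open>V N\<close>
  bounds the distance of \<open>v\<close> from \<open>\<one>\<close>.
\<close>

lemma chain_dist_one_le:
  assumes "v \<in> V N" "inv v \<in> V N"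
  shows "chain_dist v \<one> \<le> 2 / 2 ^ N"
proof (rule chain_dist_le)
  fix z assume z: "z \<in> carrier G"
  have v: "v \<in> carrier G" using assms V_carrier by blast
  have "level (z \<otimes> v) \<le> level z + 2 / 2 ^ N" using assms(1) by (rule level_mult_le)
  moreover have "level (z \<otimes> v \<otimes> inv v) \<le> level (z \<otimes> v) + 2 / 2 ^ N"
    using assms(2) by (rule level_mult_le)
  ultimately show "\<bar>level (z \<otimes> v) - level (z \<otimes> \<one>)\<bar> \<le> 2 / 2 ^ N"
    using z v by (simp add: m_assoc)
qed

lemma chain_dist_left_inv:
  assumes "x \<in> carrier G" "y \<in> carrier G" "h \<in> carrier G"
  shows "chain_dist (h \<otimes> x) (h \<otimes> y) = chain_dist x y"
proof -
  have le: "chain_dist (h \<otimes> x) (h \<otimes> y) \<le> chain_dist x y"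
    if "x \<in> carrier G" "y \<in> carrier G" "h \<in> carrier G" for x y h
  proof (rule chain_dist_le)
    fix z assume "z \<in> carrier G"
    then show "\<bar>level (z \<otimes> (h \<otimes> x)) - level (z \<otimes> (h \<otimes> y))\<bar> \<le> chain_dist x y"
      using level_diff_le_chain_dist[of "z \<otimes> h" x y] that by (simp add: m_assoc)
  qed
  show ?thesis
    using le[OF assms] le[of "h \<otimes> x" "h \<otimes> y" "inv h"] assms by (simp add: m_assoc[symmetric])
qed

lemma eq_one_if_level_zero:
  assumes "x \<in> carrier G" "level x = 0"
  shows "x = \<one>"
proof (rule ccontr)
  assume "x \<noteq> \<one>"
  then have "d x \<one> > 0" using assms(1) by (simp add: mdist_pos_less)
  then obtain n where n: "V n \<subseteq> mball \<one> (d x \<one>)" using V_small by blast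
  have "x \<in> V (Suc n)" using assms(2) by (intro in_V_if_level_less) simp
  then have "x \<otimes> \<one> \<in> V n" using V_square one_in_V by blast
  then have "x \<in> V n" using assms(1) by simp
  then show False using n by (auto simp: commute subset_iff)
qed

lemma chain_dist_Metric_space: "Metric_space (carrier G) chain_dist"
proof
  show nonneg: "chain_dist x y \<ge> 0" for x y
    using level_diff_le_chain_dist[of \<one> x y] by (smt (verit) one_closed)
  show "chain_dist x y = chain_dist y x" for x y
    unfolding chain_dist_def by (simp add: abs_minus_commute)
  fix x y assume xy: "x \<in> carrier G" "y \<in> carrier G"
  show "chain_dist x y = 0 \<longleftrightarrow> x = y"
  proof
    assume 0: "chain_dist x y = 0"
    have "level (inv y \<otimes> x) = 0"
      using level_diff_le_chain_dist[of "inv y" x y] 0 xy by (simp add: level_one)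
    then have "inv y \<otimes> x = \<one>" using xy by (intro eq_one_if_level_zero) auto
    then show "x = y" using xy by (metis inv_closed inv_equality inv_inv)
  next
    assume "x = y"
    then have "chain_dist x y \<le> 0" by (intro chain_dist_le) simp
    then show "chain_dist x y = 0" using nonneg[of x y] by simp
  qed
next
  fix x y z assume "x \<in> carrier G" "y \<in> carrier G" "z \<in> carrier G"
  show "chain_dist x z \<le> chain_dist x y + chain_dist y z"
  proof (rule chain_dist_le)
    fix w assume "w \<in> carrier G"
    then show "\<bar>level (w \<otimes> x) - level (w \<otimes> z)\<bar> \<le> chain_dist x y + chain_dist y z"
      using level_diff_le_chain_dist[of w x y] level_diff_le_chain_dist[of w y z] by linarith
  qed
qed

lemma chain_dist_inv_metric_group: "inv_metric_group G chain_dist"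
  by (intro inv_metric_group.intro inv_metric_group_axioms.intro is_group
      chain_dist_Metric_space chain_dist_left_inv)

lemma chain_dist_mtopology: "Metric_space.mtopology (carrier G) chain_dist = mtopology"
proof -
  interpret D: inv_metric_group G chain_dist by (rule chain_dist_inv_metric_group)
  have "\<exists>r>0. \<forall>x\<in>carrier G. d x \<one> < r \<longrightarrow> chain_dist x \<one> < e" if e: "e > 0" for e
  proof -
    obtain N where N: "(1 / 2) ^ N < e / 2" using real_arch_pow_inv[of "e / 2" "1 / 2"] e by auto
    obtain r where r: "r > 0" "mball \<one> r \<subseteq> V N" using V_ball by blast
    have "chain_dist x \<one> < e" if "x \<in> carrier G" "d x \<one> < r" for x
    proof -
      have "x \<in> mball \<one> r" "inv x \<in> mball \<one> r"
        unfolding mem_mball_one using that dist_inv_one by auto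
      then have "x \<in> V N" "inv x \<in> V N" using r(2) by auto
      then have "chain_dist x \<one> \<le> 2 / 2 ^ N" by (rule chain_dist_one_le)
      also have "\<dots> < e" using N by (simp add: power_one_over field_simps)
      finally show ?thesis .
    qed
    with r show ?thesis by blast
  qed
  moreover have "\<exists>r>0. \<forall>x\<in>carrier G. chain_dist x \<one> < r \<longrightarrow> d x \<one> < e" if e: "e > 0" for e
  proof -
    obtain n where n: "V n \<subseteq> mball \<one> e" using V_small e by blast
    have "d x \<one> < e" if x: "x \<in> carrier G" and less: "chain_dist x \<one> < 1 / 2 ^ Suc n" for x
    proof -
      have "x \<in> V (Suc n)"
        using level_le_chain_dist[OF x] less by (intro in_V_if_level_less) linarith
      then have "x \<otimes> \<one> \<in> V n" using V_square one_in_V by blast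
      then have "x \<in> mball \<one> e" using n x by auto
      then show ?thesis using mem_mball_one by blast
    qed
    then show ?thesis by (intro exI[of _ "1 / 2 ^ Suc n"]) auto
  qed
  ultimately have "openin D.mtopology U \<longleftrightarrow> openin mtopology U" for U
    using openin_mtopology_if_finer[OF chain_dist_inv_metric_group]
      D.openin_mtopology_if_finer[OF inv_metric_group_axioms] by blast
  then show ?thesis by (simp add: topology_eq)
qed

end

section \<open>Minimality implies the escape property\<close>

context inv_metric_group
begin

text \<open>
  The \<open>r\<close>-neighbourhood of the powers of \<open>g\<close> with exponents from \<open>-k\<close> to \<open>k\<close>.
\<close>

definition power_tube :: "'a \<Rightarrow> nat \<Rightarrow> real \<Rightarrow> 'a set" where
  "power_tube g k r = {x \<in> carrier G. \<exists>j::int. \<bar>j\<bar> \<le> int k \<and> d (g [^] j) x < r}"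

lemma power_tubeI: "\<lbrakk>x \<in> carrier G; \<bar>j\<bar> \<le> int k; d (g [^] j) x < r\<rbrakk> \<Longrightarrow> x \<in> power_tube g k r"
  unfolding power_tube_def by blast

lemma mball_subset_power_tube: "mball \<one> r \<subseteq> power_tube g k r"
proof
  fix x assume "x \<in> mball \<one> r"
  then show "x \<in> power_tube g k r" by (intro power_tubeI[of x 0]) auto
qed

lemma generator_in_power_tube:
  assumes "g \<in> carrier G" "k \<ge> 1" "r > 0"
  shows "g \<in> power_tube g k r" "inv g \<in> power_tube g k r"
proof -
  show "g \<in> power_tube g k r"
    using assms by (intro power_tubeI[of _ 1]) (auto simp: mdist_zero)
  have "g [^] (- 1 :: int) = inv g" using assms int_pow_neg[of g 1] by simp
  then show "inv g \<in> power_tube g k r"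
    using assms by (intro power_tubeI[of _ "- 1"]) (auto simp: mdist_zero)
qed

text \<open>
  In a product \<open>p w q v\<close> with \<open>p\<close>, \<open>q\<close> powers of \<open>g\<close> and \<open>w\<close>, \<open>v\<close> small, \<open>w\<close> is moved past \<open>q\<close> at
  the expense of conjugation by one of the finitely many powers \<open>q\<close>.
\<close>

lemma ex_power_tube_square:
  assumes T: "topological_group G mtopology"
    and g: "g \<in> carrier G" and r: "r > 0" and l: "2 * l \<le> k"
  shows "\<exists>s>0. power_tube g l s <#> power_tube g l s \<subseteq> power_tube g k r"
proof -
  define F where "F = (\<lambda>j::int. g [^] j) ` {- int l..int l}"
  have "finite F" "F \<subseteq> carrier G" using g by (auto simp: F_def)
  then obtain s where s: "s > 0"
    "\<forall>p\<in>F. \<forall>w\<in>carrier G. d w \<one> < s \<longrightarrow> d (inv p \<otimes> w \<otimes> p) \<one> < r / 2"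
    using ex_ball_conj_finite[OF T, of F "r / 2"] r by auto
  have "x \<otimes> y \<in> power_tube g k r"
    if xy: "x \<in> power_tube g l (min s (r / 2))" "y \<in> power_tube g l (min s (r / 2))" for x y
  proof -
    obtain i j :: int where
      x: "x \<in> carrier G" "\<bar>i\<bar> \<le> int l" "d (g [^] i) x < min s (r / 2)" and
      y: "y \<in> carrier G" "\<bar>j\<bar> \<le> int l" "d (g [^] j) y < min s (r / 2)"
      using xy unfolding power_tube_def by blast
    define p q where "p = g [^] i" and "q = g [^] j"
    have pq: "p \<in> carrier G" "q \<in> carrier G" using g by (auto simp: p_def q_def)
    have "j \<in> {- int l..int l}" using y by auto
    then have "q \<in> F" unfolding F_def q_def by (rule imageI)
    moreover have "d (inv p \<otimes> x) \<one> < s" using x pq dist_eq_dist_one[of p x] by (simp add: p_def)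
    ultimately have conj: "d (inv q \<otimes> (inv p \<otimes> x) \<otimes> q) \<one> < r / 2" using s x pq by blast
    have "d (g [^] (i + j)) (x \<otimes> y) = d (inv (p \<otimes> q) \<otimes> (x \<otimes> y)) \<one>"
      using g x y pq dist_eq_dist_one[of "p \<otimes> q" "x \<otimes> y"] by (simp add: p_def q_def int_pow_mult)
    also have "inv (p \<otimes> q) \<otimes> (x \<otimes> y) = (inv q \<otimes> (inv p \<otimes> x) \<otimes> q) \<otimes> (inv q \<otimes> y)"
    proof -
      have "q \<otimes> (inv q \<otimes> y) = y" using y pq by (simp add: m_assoc[symmetric])
      then show ?thesis using x y pq by (simp add: inv_mult_group m_assoc)
    qed
    also have "d \<dots> \<one> \<le> d (inv q \<otimes> (inv p \<otimes> x) \<otimes> q) \<one> + d (inv q \<otimes> y) \<one>"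
      using x y pq by (intro dist_one_mult_le) auto
    also have "d (inv q \<otimes> y) \<one> = d q y" using pq y dist_eq_dist_one[of q y] by simp
    also have "d (inv q \<otimes> (inv p \<otimes> x) \<otimes> q) \<one> + d q y < r"
      using conj y by (simp add: q_def)
    finally have "d (g [^] (i + j)) (x \<otimes> y) < r" .
    moreover have "\<bar>i + j\<bar> \<le> int k" using x y l by linarith
    ultimately show ?thesis using x y by (intro power_tubeI) auto
  qed
  then show ?thesis using s r
    by (intro exI[of _ "min s (r / 2)"]) (auto simp: set_mult_def)
qed

text \<open>
  A failure of the escape property yields a tube inside a given ball around \<open>\<one>\<close> whose bound \<open>m\<close> on
  the exponents exceeds \<open>1 / d g \<one>\<close>.
\<close>

lemma ex_power_tube_in_ball:
  assumes no_escape: "\<And>U. \<lbrakk>openin mtopology U; \<one> \<in> U\<rbrakk> \<Longrightarrow> \<not> escape U" and r: "r > 0"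
  shows "\<exists>g m s. g \<in> carrier G \<and> m \<ge> 1 \<and> s > 0 \<and> 1 < real m * d g \<one> \<and>
    power_tube g m s \<subseteq> mball \<one> r"
proof -
  have "\<not> escape (mball \<one> (r / 2))" using r by (intro no_escape) auto
  then obtain g and m :: nat where g: "g \<in> carrier G" and m: "m \<ge> 1"
    and pow: "\<forall>k\<in>{1..m}. g [^] k \<in> mball \<one> (r / 2)" and far: "\<not> d g \<one> \<le> 1 / real m"
    unfolding escape_def by blast
  have int_pow: "d (g [^] j) \<one> < r / 2" if j: "\<bar>j\<bar> \<le> int m" for j :: int
  proof -
    have nat_pow: "d (g [^] k) \<one> < r / 2" if "k \<le> m" for k :: nat
    proof (cases "k = 0")
      case True
      then show ?thesis using r by (simp add: mdist_zero)
    next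
      case False
      then have "k \<in> {1..m}" using that by auto
      then show ?thesis using pow mem_mball_one by blast
    qed
    show ?thesis
    proof (cases j rule: int_cases2)
      case (nonneg k)
      then show ?thesis using j nat_pow[of k] by (simp add: int_pow_int)
    next
      case (nonpos k)
      then show ?thesis
        using j nat_pow[of k] g by (simp add: int_pow_neg int_pow_int dist_inv_one)
    qed
  qed
  have "power_tube g m (r / 2) \<subseteq> mball \<one> r"
  proof
    fix x assume "x \<in> power_tube g m (r / 2)"
    then obtain j :: int where
      x: "x \<in> carrier G" "\<bar>j\<bar> \<le> int m" "d (g [^] j) x < r / 2"
      unfolding power_tube_def by blast
    have "d x \<one> \<le> d x (g [^] j) + d (g [^] j) \<one>" using x g by (intro triangle) auto
    also have "\<dots> < r" using x int_pow[OF x(2)] by (simp add: commute)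
    finally show "x \<in> mball \<one> r" using x mem_mball_one by blast
  qed
  moreover have "1 < real m * d g \<one>" using far m by (simp add: field_simps)
  ultimately show ?thesis using g m r by (intro exI[of _ g] exI[of _ m] exI[of _ "r / 2"]) auto
qed

text \<open>
  A sequence of tubes, each containing the square of the next. While the exponent bound \<open>k n\<close> is at
  least \<open>2\<close> it is halved and the generator is kept; once it is \<open>1\<close>, the next tube is generated by a
  new element with \<open>1 < k * d g \<one>\<close> and lies in a ball whose radius depends on the index only.
\<close>

definition tube_chain :: "(nat \<Rightarrow> 'a) \<Rightarrow> (nat \<Rightarrow> nat) \<Rightarrow> (nat \<Rightarrow> real) \<Rightarrow> bool" where
  "tube_chain g k r \<longleftrightarrow> (\<forall>n.
    (g n \<in> carrier G \<and> k n \<ge> 1 \<and> r n > 0) \<and>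
    power_tube (g (Suc n)) (k (Suc n)) (r (Suc n)) <#>
      power_tube (g (Suc n)) (k (Suc n)) (r (Suc n)) \<subseteq> power_tube (g n) (k n) (r n) \<and>
    (k n \<ge> 2 \<longrightarrow> g (Suc n) = g n \<and> k (Suc n) = k n div 2) \<and>
    (k n = 1 \<longrightarrow> 1 < real (k (Suc n)) * d (g (Suc n)) \<one> \<and>
      power_tube (g (Suc n)) (k (Suc n)) (r (Suc n)) \<subseteq> mball \<one> (1 / 2 ^ n)))"

lemma ex_tube_chain:
  assumes T: "topological_group G mtopology"
    and no_escape: "\<And>U. \<lbrakk>openin mtopology U; \<one> \<in> U\<rbrakk> \<Longrightarrow> \<not> escape U"
  shows "\<exists>g k r. tube_chain g k r"
proof -
  define P where "P = (\<lambda>(g, k, r). g \<in> carrier G \<and> k \<ge> (1::nat) \<and> r > (0::real))"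
  define Q where "Q = (\<lambda>(n::nat) (g, k::nat, r::real) (g', k', r').
    power_tube g' k' r' <#> power_tube g' k' r' \<subseteq> power_tube g k r \<and>
    (k \<ge> 2 \<longrightarrow> g' = g \<and> k' = k div 2) \<and>
    (k = 1 \<longrightarrow> 1 < real k' * d g' \<one> \<and> power_tube g' k' r' \<subseteq> mball \<one> (1 / 2 ^ n)))"
  have step: "\<exists>y. P y \<and> Q n x y" if "P x" for x n
  proof -
    obtain g k r where x: "x = (g, k, r)" by (cases x)
    have gkr: "g \<in> carrier G" "k \<ge> 1" "r > 0" using that by (auto simp: P_def x)
    show ?thesis
    proof (cases "k \<ge> 2")
      case True
      obtain s where "s > 0"
        "power_tube g (k div 2) s <#> power_tube g (k div 2) s \<subseteq> power_tube g k r"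
        using ex_power_tube_square[OF T gkr(1,3), of "k div 2" k] by auto
      then show ?thesis using True gkr
        by (intro exI[of _ "(g, k div 2, s)"]) (auto simp: P_def Q_def x)
    next
      case False
      then have k: "k = 1" using gkr by simp
      define e where "e = min (r / 2) (1 / 2 ^ n)"
      have "e > 0" using gkr by (simp add: e_def)
      then obtain h m s where h: "h \<in> carrier G" "m \<ge> 1" "s > 0" "1 < real m * d h \<one>"
        and tube: "power_tube h m s \<subseteq> mball \<one> e"
        using ex_power_tube_in_ball[OF no_escape] by metis
      have "power_tube h m s <#> power_tube h m s \<subseteq> power_tube g k r"
      proof
        fix z assume "z \<in> power_tube h m s <#> power_tube h m s"
        then obtain u v where z: "z = u \<otimes> v" and "u \<in> power_tube h m s" "v \<in> power_tube h m s"
          unfolding set_mult_def by blast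
        then have uv: "u \<in> carrier G" "v \<in> carrier G" "d u \<one> < e" "d v \<one> < e"
          using tube mem_mball_one by blast+
        then have "d z \<one> < r" using dist_one_mult_le[OF uv(1,2)] by (simp add: z e_def)
        then have "z \<in> mball \<one> r" using uv z mem_mball_one by blast
        then show "z \<in> power_tube g k r" using mball_subset_power_tube by blast
      qed
      moreover have "power_tube h m s \<subseteq> mball \<one> (1 / 2 ^ n)"
        using tube mball_subset_concentric[of e "1 / 2 ^ n" \<one>] by (auto simp: e_def)
      ultimately show ?thesis using h k
        by (intro exI[of _ "(h, m, s)"]) (simp add: P_def Q_def x)
    qed
  qed
  \<comment> \<open>The chain starts with the open unit ball, viewed as a tube around the powers of \<open>\<one>\<close>.\<close>
  have "\<exists>f. \<forall>n. P (f n) \<and> Q n (f n) (f (Suc n))"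
  proof (rule dependent_nat_choice)
    show "\<exists>x. P x" by (rule exI[of _ "(\<one>, 1, 1)"]) (simp add: P_def)
  qed (rule step)
  then obtain f where f: "\<And>n. P (f n)" "\<And>n. Q n (f n) (f (Suc n))" by blast
  have "tube_chain (\<lambda>n. fst (f n)) (\<lambda>n. fst (snd (f n))) (\<lambda>n. snd (snd (f n)))"
    using f unfolding tube_chain_def P_def Q_def by (simp add: case_prod_beta)
  then show ?thesis by blast
qed

lemma minimal_imp_escape:
  assumes T: "topological_group G mtopology" and min: "minimal_metric G mtopology d"
  shows "\<exists>U. openin mtopology U \<and> \<one> \<in> U \<and> escape U"
proof (rule ccontr)
  assume "\<not> ?thesis"
  then obtain g k r where chain: "tube_chain g k r"
    using ex_tube_chain[OF T] by blast
  define A where "A n = power_tube (g n) (k n) (r n)" for n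
  have g: "g n \<in> carrier G" and k: "k n \<ge> 1" and r: "r n > 0" for n
    using chain by (auto simp: tube_chain_def)
  have A_square: "A (Suc n) <#> A (Suc n) \<subseteq> A n" for n
    using chain by (simp add: A_def tube_chain_def)
  have halve: "g (Suc n) = g n" "k (Suc n) = k n div 2" if "k n \<ge> 2" for n
    using chain that by (auto simp: tube_chain_def)
  have restart: "1 < real (k (Suc n)) * d (g (Suc n)) \<one>" "A (Suc n) \<subseteq> mball \<one> (1 / 2 ^ n)"
    if "k n = 1" for n
    using chain that by (auto simp: A_def tube_chain_def simp del: in_mball)

  have restarts: "\<exists>n\<ge>N. k n = 1" for N
  proof (induction "k N" arbitrary: N rule: less_induct)
    case less
    show ?case
    proof (cases "k N \<ge> 2")
      case True
      then have "k (Suc N) < k N" using halve by simp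
      then show ?thesis using less[of "Suc N"] Suc_leD by blast
    next
      case False
      then show ?thesis using k[of N] by (intro exI[of _ N]) auto
    qed
  qed

  have A_one: "\<one> \<in> A n" for n
    using mball_subset_power_tube r by (auto simp: A_def subset_iff)
  have A_carrier: "A n \<subseteq> carrier G" for n by (auto simp: A_def power_tube_def)
  have "A (Suc n) \<subseteq> A n" for n
  proof
    fix x assume x: "x \<in> A (Suc n)"
    then have "x \<otimes> \<one> \<in> A n" using A_square A_one unfolding set_mult_def by blast
    moreover have "x \<in> carrier G" using x A_carrier by blast
    ultimately show "x \<in> A n" by simp
  qed
  then have A_anti: "A m \<subseteq> A n" if "n \<le> m" for m n
    using lift_Suc_antimono_le[of A] that by blast
  have A_small: "\<exists>N. A N \<subseteq> mball \<one> e" if e: "e > 0" for e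
  proof -
    obtain M where M: "(1 / 2) ^ M < e" using real_arch_pow_inv[of e "1 / 2"] e by auto
    obtain n where n: "n \<ge> M" "k n = 1" using restarts by blast
    have "(1::real) / 2 ^ n \<le> (1 / 2) ^ M"
      using n(1) power_decreasing[of M n "1/2::real"] by (simp add: power_one_over)
    then have "mball \<one> (1 / 2 ^ n) \<subseteq> mball \<one> e" using M by (intro mball_subset_concentric) simp
    then show ?thesis using restart(2)[OF n(2)] by blast
  qed

  interpret C: square_chain G d A
  proof
    show "A n \<subseteq> carrier G" for n by (rule A_carrier)
    show "\<exists>s>0. mball \<one> s \<subseteq> A n" for n
      using mball_subset_power_tube r A_def by blast
    show "x \<otimes> y \<in> A n" if "x \<in> A (Suc n)" "y \<in> A (Suc n)" for x y n
      using A_square that unfolding set_mult_def by blast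
  qed (rule A_small)

  have "compatible_metric G mtopology C.chain_dist \<and> left_invariant_metric G C.chain_dist"
    by (simp add: compatible_metric_def left_invariant_metric_def C.chain_dist_Metric_space
        C.chain_dist_mtopology C.chain_dist_left_inv)
  then obtain U K where U: "\<one> \<in> mtopology interior_of U"
    and le: "\<forall>g\<in>U. \<forall>f\<in>U. d g f \<le> K * C.chain_dist g f"
    using min unfolding minimal_metric_def by blast
  obtain e where e: "e > 0" "mball \<one> e \<subseteq> mtopology interior_of U"
    using U by (rule ex_mball_one_subset[OF openin_interior_of])
  have ball_U: "mball \<one> e \<subseteq> U" using e(2) interior_of_subset by (rule subset_trans)
  obtain N where N: "A N \<subseteq> mball \<one> e" using A_small e(1) by blast
  obtain M where M: "4 * K < 2 ^ M" using real_arch_pow[of 2 "4 * K"] by auto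
  obtain n0 where n0: "n0 \<ge> max N M" "k n0 = 1" using restarts by blast

  \<comment> \<open>The quantity \<open>(k n + 1) * d (g n) \<one> * 2 ^ n\<close> does not decrease when \<open>k n\<close> is halved, because
    \<open>k + 1 \<le> 2 * (k div 2 + 1)\<close>, and it exceeds \<open>2 ^ n\<close> whenever a new generator enters at index \<open>n\<close>.\<close>
  have large: "2 ^ M < real (k n + 1) * d (g n) \<one> * 2 ^ n" if "n \<ge> Suc n0" for n
  proof -
    have new: "2 ^ M < real (k (Suc n) + 1) * d (g (Suc n)) \<one> * 2 ^ Suc n"
      if n: "n \<ge> n0" "k n = 1" for n
    proof -
      have "1 < real (k (Suc n)) * d (g (Suc n)) \<one>" using restart(1) n by blast
      also have "\<dots> \<le> real (k (Suc n) + 1) * d (g (Suc n)) \<one>"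
        by (intro mult_right_mono) auto
      finally have "1 * 2 ^ Suc n < real (k (Suc n) + 1) * d (g (Suc n)) \<one> * 2 ^ Suc n"
        by (intro mult_strict_right_mono) auto
      moreover have "(2::real) ^ M \<le> 2 ^ Suc n" using n n0 by (intro power_increasing) auto
      ultimately show ?thesis by linarith
    qed
    show ?thesis using that
    proof (induction n rule: dec_induct)
      case base
      show ?case using new[of n0] n0 by simp
    next
      case (step n)
      show ?case
      proof (cases "k n \<ge> 2")
        case True
        have "k n + 1 \<le> 2 * (k n div 2 + 1)" by presburger
        then have "real (k n + 1) \<le> 2 * real (k n div 2 + 1)"
          by (metis of_nat_le_iff of_nat_mult of_nat_numeral)
        then have "real (k n + 1) * (d (g n) \<one> * 2 ^ n) \<le> 2 * real (k n div 2 + 1) * (d (g n) \<one> * 2 ^ n)"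
          by (intro mult_right_mono) auto
        then have "2 ^ M < 2 * real (k n div 2 + 1) * (d (g n) \<one> * 2 ^ n)"
          using step.IH unfolding mult.assoc by linarith
        also have "\<dots> = real (k (Suc n) + 1) * d (g (Suc n)) \<one> * 2 ^ Suc n"
          using halve[OF True] by simp
        finally show ?thesis .
      next
        case False
        then have "k n = 1" using k[of n] by simp
        then show ?thesis using new[of n] step.hyps by simp
      qed
    qed
  qed
  \<comment> \<open>At the next index with \<open>k n = 1\<close> the generator is too close to the identity for the new metric.\<close>
  obtain n where n: "n \<ge> Suc n0" "k n = 1" using restarts by blast
  have mem: "g n \<in> A n" "inv (g n) \<in> A n"
    using generator_in_power_tube[OF g k r] by (auto simp: A_def)
  have "g n \<in> U" using mem(1) A_anti[of N n] n(1) n0(1) N ball_U by auto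
  moreover have "\<one> \<in> U" using ball_U e(1) by (auto simp: subset_iff)
  ultimately have d_le: "d (g n) \<one> \<le> K * C.chain_dist (g n) \<one>" using le by blast
  have dist: "C.chain_dist (g n) \<one> \<le> 2 / 2 ^ n" using mem by (rule C.chain_dist_one_le)
  have "2 ^ M < 2 * d (g n) \<one> * 2 ^ n" using large[OF n(1)] n(2) by simp
  also have "\<dots> \<le> 2 * (K * C.chain_dist (g n) \<one>) * 2 ^ n"
    using d_le by (intro mult_right_mono mult_left_mono) auto
  finally have "2 ^ M < K * (2 * C.chain_dist (g n) \<one> * 2 ^ n)" by (simp add: mult_ac)
  moreover have "2 * C.chain_dist (g n) \<one> * 2 ^ n \<le> 4" using dist by (simp add: field_simps)
  moreover have "0 \<le> 2 * C.chain_dist (g n) \<one> * 2 ^ n"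
    using Metric_space.nonneg[OF C.chain_dist_Metric_space] by simp
  moreover have "K \<ge> 0"
  proof (rule ccontr)
    assume "\<not> K \<ge> 0"
    then have "K * (2 * C.chain_dist (g n) \<one> * 2 ^ n) \<le> 0"
      using calculation(3) by (intro mult_nonpos_nonneg) auto
    then show False using calculation(1) zero_less_power[of "2::real" M] by linarith
  qed
  ultimately have "2 ^ M < K * 4"
    by (meson less_le_trans mult_left_mono)
  then show False using M by simp
qed

end

section \<open>Characterisations of minimal metrics\<close>

theorem theorem2:
  fixes G :: "('a, 'b) monoid_scheme" (structure)
    and T :: "'a topology"
    and d :: "'a \<Rightarrow> 'a \<Rightarrow> real"
  assumes "topological_group G T"
    and "compatible_metric G T d"
    and "left_invariant_metric G d"
  shows "let
      cond1 = minimal_metric G T d;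
      cond2 = (\<exists>U. openin T U \<and> \<one> \<in> U \<and>
        (\<forall>g\<in>carrier G. \<forall>n::nat. n \<ge> 1 \<longrightarrow>
          (\<forall>k\<in>{1..n}. g [^] k \<in> U) \<longrightarrow> d g \<one> \<le> 1 / real n));
      cond3 = (\<exists>\<epsilon> K::real. \<epsilon> > 0 \<and> K \<ge> 1 \<and>
        (\<forall>g\<in>carrier G. \<forall>n::nat. n \<ge> 1 \<longrightarrow>
          d g \<one> \<le> \<epsilon> / real n \<longrightarrow> real n * d g \<one> \<le> K * d (g [^] n) \<one>));
      cond4 = (\<exists>U. \<exists>K::real. openin T U \<and> \<one> \<in> U \<and> K \<ge> 1 \<and>
        (\<forall>g\<in>carrier G. \<forall>n::nat. n \<ge> 1 \<longrightarrow>
          (\<forall>k\<in>{0..n}. g [^] ((2::nat) ^ k) \<in> U) \<longrightarrow>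
          2 ^ n * d g \<one> \<le> K * d (g [^] ((2::nat) ^ n)) \<one>))
    in (cond1 \<longleftrightarrow> cond2) \<and> (cond2 \<longleftrightarrow> cond3) \<and> (cond3 \<longleftrightarrow> cond4)"
proof -
  interpret inv_metric_group G d
    using assms unfolding topological_group_def compatible_metric_def left_invariant_metric_def
    by (intro inv_metric_group.intro inv_metric_group_axioms.intro) auto
  have top: "mtopology = T" using assms(2) by (simp add: compatible_metric_def)
  define c2 where "c2 \<longleftrightarrow> (\<exists>U. openin T U \<and> \<one> \<in> U \<and> escape U)"
  define c3 where "c3 \<longleftrightarrow> (\<exists>\<epsilon> K. \<epsilon> > 0 \<and> K \<ge> 1 \<and> linear_growth \<epsilon> K)"
  define c4 where "c4 \<longleftrightarrow> (\<exists>U K. openin T U \<and> \<one> \<in> U \<and> K \<ge> 1 \<and> dyadic_growth U K)"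
  have "minimal_metric G T d \<longleftrightarrow> c2"
    using minimal_imp_escape escape_imp_minimal assms(1) unfolding c2_def top by blast
  moreover have "c2 \<Longrightarrow> c3"
    using escape_imp_linear_growth unfolding c2_def c3_def top by blast
  moreover have "c4" if c3
  proof -
    from that obtain \<epsilon> K where eK: "\<epsilon> > 0" "K \<ge> 1" "linear_growth \<epsilon> K"
      unfolding c3_def by blast
    moreover have "\<one> \<in> mball \<one> (\<epsilon> / (2 * K))" using eK by simp
    moreover have "openin T (mball \<one> (\<epsilon> / (2 * K)))" unfolding top[symmetric] by (rule openin_mball)
    ultimately show ?thesis using linear_growth_imp_dyadic_growth unfolding c4_def by blast
  qed
  moreover have "c2" if c4
  proof -
    from that obtain U K where UK: "openin T U" "\<one> \<in> U" "K \<ge> 1" "dyadic_growth U K"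
      unfolding c4_def by blast
    let ?U = "U \<inter> mball \<one> (1 / (2 * K))"
    have "openin T (mball \<one> (1 / (2 * K)))" unfolding top[symmetric] by (rule openin_mball)
    then have "openin T ?U" using UK(1) by (rule openin_Int[rotated])
    moreover have "\<one> \<in> ?U" using UK by simp
    ultimately show ?thesis using dyadic_growth_imp_escape[OF UK(3,4)] unfolding c2_def by blast
  qed
  ultimately have "(minimal_metric G T d \<longleftrightarrow> c2) \<and> (c2 \<longleftrightarrow> c3) \<and> (c3 \<longleftrightarrow> c4)" by blast
  then show ?thesis
    unfolding Let_def c2_def c3_def c4_def escape_def linear_growth_def dyadic_growth_def .
qed

end
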